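(* Let $(\theta_k)_{k\in\mathbb{N}}\subseteq(0,\pi/4)$ be a sequence decreasing to $0$, let $(N_k)_{k\in\mathbb{N}}$ be a sequence of positive integers, let $(\sigma_k)_{k\in\mathbb{N}}\subseteq[1,+\infty)$, and let $$\boldsymbol{\theta}=\left\{\theta_{k+1}+\frac{i-1}{N_k}(\theta_k-\theta_{k+1}) : k\in\mathbb{N},\ 1\leq i\leq N_k\right\}.$$ Let $\boldsymbol{\sigma}:\boldsymbol{\theta}\to[1,+\infty)$ be defined by $\boldsymbol{\sigma}\left(\theta_{k+1}+\frac{i-1}{N_k}(\theta_k-\theta_{k+1})\right)=\sigma_k$ for all $k\in\mathbb{N}$ and $1\leq i\leq N_k$. Assume that for each $k\in\mathbb{N}$ $$\sin\left(\frac{\theta_k-\theta_{k+1}}{N_k}\right)\geq\frac{4}{\sigma_k}.$$ Let $\Phi:[0,+\infty)\to[0,+\infty)$ be a Young function. If the homothecy-invariant basis $\mathscr{B}^{\boldsymbol{\sigma}}$ differentiates the Orlicz space $L^\Phi(\mathbb{R}^2)$, then $N_k\sigma_k=O(\Phi(\sigma_k))$ as $k\to\infty$.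
   Context: Rectangles in $\mathbb{R}^2$ are open and nondegenerate, with arbitrary orientation. The shape $\sigma(R)$ of a rectangle $R$ is the quotient of its longest side-length by its shortest side-length. $\mathscr{B}^{\boldsymbol{\sigma}}$ denotes the collection of all rectangles $R$ for which there exists $\theta\in\boldsymbol{\theta}$ such that the longest side of $R$ makes an angle $\theta$ with the horizontal line and $\sigma(R)=\boldsymbol{\sigma}(\theta)$ (all positions and all sizes are allowed). A (Buseman-Feller) differentiation basis is a collection $\mathscr{B}$ of open subsets of $\mathbb{R}^2$ such that $\inf\{\operatorname{diam}B: B\in\mathscr{B},\ x\in B\}=0$ for every $x\in\mathbb{R}^2$. It is homothecy-invariant if $x+\lambda B\in\mathscr{B}$ for all $B\in\mathscr{B}$, $x\in\mathbb{R}^2$, $\lambda>0$. For $f\in L^1_{\mathrm{loc}}(\mathbb{R}^2)$, $\mathscr{B}$ differentiates $\int f$ if for a.e. $x\in\mathbb{R}^2$ one has $\frac{1}{|B|}\int_B f\to f(x)$ as $\operatorname{diam}B\to0$ with $x\in B\in\mathscr{B}$. For $X\subseteq L^1_{\mathrm{loc}}(\mathbb{R}^2)$, $\mathscr{B}$ differentiates $X$ if it differentiates $\int f$ for every $f\in X$. A Young function is a convex nondecreasing function $\Phi:[0,\infty)\to[0,\infty)$, not identically zero, with $\Phi(0)=0$; $L^\Phi(\mathbb{R}^2)$ is the Orlicz space of measurable $f$ with $\int_{\mathbb{R}^2}\Phi(|f|/\mu)<\infty$ for some $\mu>0$. For nonnegative $a_k$ and positive $b_k$, $a_k=O(b_k)$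 means that $a_k/b_k$ remains bounded as $k\to\infty$. *)

theory Defs
  imports "HOL-Analysis.Analysis" "HOL-Library.Landau_Symbols"
begin

text \<open>
  The open rectangle with one vertex at \<open>p\<close>, one side of length \<open>a\<close> making the (oriented,
  counterclockwise) angle \<open>t\<close> with the horizontal direction, and the adjacent side of length \<open>b\<close>
  orthogonal to it.
\<close>

definition rectangle :: "real^2 \<Rightarrow> real \<Rightarrow> real \<Rightarrow> real \<Rightarrow> (real^2) set" where
  "rectangle p t a b =
     {p + u *\<^sub>R vector [cos t, sin t] + v *\<^sub>R vector [- sin t, cos t] | u v.
        0 < u \<and> u < a \<and> 0 < v \<and> v < b}"

text \<open>
  Here \<open>a\<close> is the longest and \<open>b\<close> the shortest side-length, so \<open>a / b\<close> is the shape of the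
  rectangle. Only the values of \<open>shape\<close> on \<open>\<Theta>\<close> matter.
\<close>

definition rectangle_basis :: "real set \<Rightarrow> (real \<Rightarrow> real) \<Rightarrow> (real^2) set set" where
  "rectangle_basis \<Theta> shape =
     {rectangle p t a b | p t a b. t \<in> \<Theta> \<and> 0 < b \<and> b \<le> a \<and> a / b = shape t}"

text \<open>
  The library's \<open>diameter\<close> is real-valued and meaningless on unbounded sets; their diameter is
  infinite, so they are discarded explicitly wherever a small diameter is required.
\<close>

definition differentiation_basis :: "(real^2) set set \<Rightarrow> bool" where
  "differentiation_basis \<B> \<longleftrightarrow>
     (\<forall>B\<in>\<B>. open B) \<and>
     (\<forall>x. \<forall>e>0. \<exists>B\<in>\<B>. x \<in> B \<and> bounded B \<and> diameter B < e)"

definition homothecy_invariant :: "(real^2) set set \<Rightarrow> bool" where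
  "homothecy_invariant \<B> \<longleftrightarrow> (\<forall>B\<in>\<B>. \<forall>x. \<forall>l>0. (\<lambda>y. x + l *\<^sub>R y) ` B \<in> \<B>)"

definition L1_loc :: "(real^2 \<Rightarrow> real) set" where
  "L1_loc = {f. \<forall>K. compact K \<longrightarrow> set_integrable lebesgue K f}"

definition average :: "(real^2 \<Rightarrow> real) \<Rightarrow> (real^2) set \<Rightarrow> real" where
  "average f B = (LINT y:B|lebesgue. f y) / measure lebesgue B"

definition contracting_to :: "(real^2) set set \<Rightarrow> real^2 \<Rightarrow> (real^2) set filter" where
  "contracting_to \<B> x =
     inf (filtercomap diameter (nhds 0)) (principal {B \<in> \<B>. x \<in> B \<and> bounded B})"

definition differentiates_integral :: "(real^2) set set \<Rightarrow> (real^2 \<Rightarrow> real) \<Rightarrow> bool" where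
  "differentiates_integral \<B> f \<longleftrightarrow>
     (AE x in lebesgue. (average f \<longlongrightarrow> f x) (contracting_to \<B> x))"

text \<open>Meant for \<open>X \<subseteq> L1_loc\<close>; see \<open>orlicz_space_subset_L1_loc\<close> below.\<close>

definition differentiates :: "(real^2) set set \<Rightarrow> (real^2 \<Rightarrow> real) set \<Rightarrow> bool" where
  "differentiates \<B> X \<longleftrightarrow> (\<forall>f\<in>X. differentiates_integral \<B> f)"

text \<open>Values of \<open>\<Phi>\<close> at negative arguments are irrelevant.\<close>

definition young_function :: "(real \<Rightarrow> real) \<Rightarrow> bool" where
  "young_function \<Phi> \<longleftrightarrow>
     (\<forall>t\<ge>0. 0 \<le> \<Phi> t) \<and> convex_on {0..} \<Phi> \<and> mono_on {0..} \<Phi> \<and>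
     \<Phi> 0 = 0 \<and> (\<exists>t\<ge>0. \<Phi> t \<noteq> 0)"

definition orlicz_space :: "(real \<Rightarrow> real) \<Rightarrow> (real^2 \<Rightarrow> real) set" where
  "orlicz_space \<Phi> = {f. f \<in> borel_measurable lebesgue \<and>
     (\<exists>\<mu>>0. (\<integral>\<^sup>+x. ennreal (\<Phi> (\<bar>f x\<bar> / \<mu>)) \<partial>lebesgue) < \<infinity>)}"

lemma contracting_tendsto_iff:
  "(average f \<longlongrightarrow> l) (contracting_to \<B> x) \<longleftrightarrow>
     (\<forall>e>0. \<exists>d>0. \<forall>B\<in>\<B>. x \<in> B \<and> bounded B \<and> diameter B < d \<longrightarrow> \<bar>average f B - l\<bar> < e)"
proof -
  have ev: "eventually P (contracting_to \<B> x) \<longleftrightarrow>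
     (\<exists>d>0. \<forall>B\<in>\<B>. x \<in> B \<and> bounded B \<and> diameter B < d \<longrightarrow> P B)" for P
  proof
    assume "eventually P (contracting_to \<B> x)"
    then obtain Q where Q: "eventually Q (nhds (0::real))"
      "\<And>B. Q (diameter B) \<Longrightarrow> B \<in> \<B> \<and> x \<in> B \<and> bounded B \<longrightarrow> P B"
      unfolding contracting_to_def eventually_inf_principal eventually_filtercomap by auto
    from Q(1) obtain d where "d > 0" "\<And>r. dist r 0 < d \<Longrightarrow> Q r"
      unfolding eventually_nhds_metric by auto
    moreover have "dist (diameter B) 0 < d" if "bounded B" "diameter B < d" for B :: "(real^2) set"
      using that diameter_ge_0[of B] by (simp add: dist_real_def)
    ultimately show "\<exists>d>0. \<forall>B\<in>\<B>. x \<in> B \<and> bounded B \<and> diameter B < d \<longrightarrow> P B"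
      using Q(2) by blast
  next
    assume "\<exists>d>0. \<forall>B\<in>\<B>. x \<in> B \<and> bounded B \<and> diameter B < d \<longrightarrow> P B"
    then obtain d where d: "d > 0" "\<forall>B\<in>\<B>. x \<in> B \<and> bounded B \<and> diameter B < d \<longrightarrow> P B"
      by auto
    have "eventually (\<lambda>r. r < d) (nhds (0::real))"
      using d(1) by (auto simp: eventually_nhds_metric dist_real_def intro!: exI[of _ d])
    then show "eventually P (contracting_to \<B> x)"
      unfolding contracting_to_def eventually_inf_principal eventually_filtercomap
      using d(2) by auto
  qed
  show ?thesis
    by (simp add: tendsto_iff ev dist_real_def)
qed

lemma rectangle_eq:
  "rectangle p t a b =
     {x. 0 < (x - p) \<bullet> vector [cos t, sin t] \<and> (x - p) \<bullet> vector [cos t, sin t] < a \<and>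
         0 < (x - p) \<bullet> vector [- sin t, cos t] \<and> (x - p) \<bullet> vector [- sin t, cos t] < b}"
  (is "?L = ?R")
proof -
  let ?e = "vector [cos t, sin t] :: real^2" and ?n = "vector [- sin t, cos t] :: real^2"
  have on: "?e \<bullet> ?e = 1" "?n \<bullet> ?n = 1" "?e \<bullet> ?n = 0" "?n \<bullet> ?e = 0"
    by (simp_all add: inner_vec_def sum_2 sin_cos_squared_add3 flip: power2_eq_square)
  have ex: "y = (y \<bullet> ?e) *\<^sub>R ?e + (y \<bullet> ?n) *\<^sub>R ?n" for y
  proof -
    have "s = (s * cos t + r * sin t) * cos t - (r * cos t - s * sin t) * sin t" for s r :: real
      using sin_cos_squared_add[of t] by algebra
    moreover have "r = (s * cos t + r * sin t) * sin t + (r * cos t - s * sin t) * cos t" for s r :: real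
      using sin_cos_squared_add[of t] by algebra
    ultimately show ?thesis
      by (simp add: vec_eq_iff forall_2 inner_vec_def sum_2)
  qed
  show ?thesis
  proof (intro set_eqI iffI)
    fix x assume "x \<in> ?L"
    then show "x \<in> ?R"
      unfolding rectangle_def by (auto simp: algebra_simps inner_add_left on)
  next
    fix x assume "x \<in> ?R"
    moreover have "x = p + ((x - p) \<bullet> ?e) *\<^sub>R ?e + ((x - p) \<bullet> ?n) *\<^sub>R ?n"
      using ex[of "x - p"] by (simp add: algebra_simps)
    ultimately show "x \<in> ?L"
      unfolding rectangle_def by blast
  qed
qed

lemma open_rectangle: "open (rectangle p t a b)"
  unfolding rectangle_eq by (intro open_Collect_conj open_Collect_less continuous_intros)

lemma dist_rectangle:
  assumes "x \<in> rectangle p t a b"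
  shows "norm (x - p) \<le> a + b"
proof -
  obtain u v where uv: "0 < u" "u < a" "0 < v" "v < b"
    "x = p + u *\<^sub>R vector [cos t, sin t] + v *\<^sub>R vector [- sin t, cos t]"
    using assms unfolding rectangle_def by auto
  have "norm (vector [cos t, sin t] :: real^2) = 1" "norm (vector [- sin t, cos t] :: real^2) = 1"
    by (simp_all add: norm_eq_1 inner_vec_def sum_2 flip: power2_eq_square)
  then have "norm (u *\<^sub>R vector [cos t, sin t] + v *\<^sub>R vector [- sin t, cos t] :: real^2) \<le> u + v"
    using norm_triangle_ineq[of "u *\<^sub>R vector [cos t, sin t] :: real^2" "v *\<^sub>R vector [- sin t, cos t]"]
      uv by simp
  then show ?thesis using uv by (simp add: add.assoc)
qed

lemma bounded_rectangle: "bounded (rectangle p t a b)"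
  by (rule boundedI[of _ "norm p + (a + b)"])
     (smt (verit) dist_rectangle norm_triangle_sub)

lemma diameter_rectangle_le:
  assumes "0 \<le> a" "0 \<le> b"
  shows "diameter (rectangle p t a b) \<le> 2 * (a + b)"
proof (rule diameter_le)
  fix x y assume "x \<in> rectangle p t a b" "y \<in> rectangle p t a b"
  then show "norm (x - y) \<le> 2 * (a + b)"
    using dist_rectangle[of x] dist_rectangle[of y] norm_triangle_ineq4[of "x - p" "y - p"] by fastforce
qed (use assms in auto)

lemma rectangle_basis_basis:
  assumes "\<Theta> \<noteq> {}" "\<And>t. t \<in> \<Theta> \<Longrightarrow> 1 \<le> shape t"
  shows "differentiation_basis (rectangle_basis \<Theta> shape)"
proof -
  obtain t where t: "t \<in> \<Theta>" "1 \<le> shape t" using assms by auto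
  have "\<exists>B\<in>rectangle_basis \<Theta> shape. x \<in> B \<and> bounded B \<and> diameter B < e" if "e > 0" for x e
  proof -
    define b where "b = e / (4 * (shape t + 1))"
    define a where "a = shape t * b"
    define p where "p = x - (a/2) *\<^sub>R vector [cos t, sin t] - (b/2) *\<^sub>R vector [- sin t, cos t]"
    have b: "0 < b" using that t by (simp add: b_def)
    then have a: "b \<le> a" "a / b = shape t" using t by (simp_all add: a_def)
    have "b * (4 * (shape t + 1)) = e" using t by (simp add: b_def)
    then have "4 * (a + b) = e" by (simp add: a_def algebra_simps)
    then have "diameter (rectangle p t a b) < e"
      using diameter_rectangle_le[of a b p t] a b that by linarith
    moreover have "x \<in> rectangle p t a b"
      unfolding rectangle_def mem_Collect_eq using a b
      by (intro exI[of _ "a/2"] exI[of _ "b/2"]) (simp add: p_def)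
    moreover have "rectangle p t a b \<in> rectangle_basis \<Theta> shape"
      unfolding rectangle_basis_def using a b t by blast
    ultimately show ?thesis using bounded_rectangle by blast
  qed
  moreover have "\<forall>B\<in>rectangle_basis \<Theta> shape. open B"
    by (auto simp: rectangle_basis_def open_rectangle)
  ultimately show ?thesis unfolding differentiation_basis_def by blast
qed

lemma rectangle_homothecy:
  assumes "l > 0"
  shows "(\<lambda>y. x + l *\<^sub>R y) ` rectangle p t a b = rectangle (x + l *\<^sub>R p) t (l * a) (l * b)"
proof (intro set_eqI iffI)
  fix z assume "z \<in> (\<lambda>y. x + l *\<^sub>R y) ` rectangle p t a b"
  then obtain u v where "0 < u" "u < a" "0 < v" "v < b"
    "z = x + l *\<^sub>R (p + u *\<^sub>R vector [cos t, sin t] + v *\<^sub>R vector [- sin t, cos t])"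
    by (auto simp: rectangle_def)
  then show "z \<in> rectangle (x + l *\<^sub>R p) t (l * a) (l * b)"
    unfolding rectangle_def mem_Collect_eq using assms
    by (intro exI[of _ "l * u"] exI[of _ "l * v"]) (simp add: algebra_simps)
next
  fix z assume "z \<in> rectangle (x + l *\<^sub>R p) t (l * a) (l * b)"
  then obtain u v where uv: "0 < u" "u < l * a" "0 < v" "v < l * b"
    "z = x + l *\<^sub>R p + u *\<^sub>R vector [cos t, sin t] + v *\<^sub>R vector [- sin t, cos t]"
    by (auto simp: rectangle_def)
  let ?y = "p + (u / l) *\<^sub>R vector [cos t, sin t] + (v / l) *\<^sub>R vector [- sin t, cos t] :: real^2"
  have "z = x + l *\<^sub>R ?y" using uv assms by (simp add: scaleR_add_right)
  moreover have "0 < u / l" "u / l < a" "0 < v / l" "v / l < b"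
    using uv assms by (auto simp: field_simps)
  then have "?y \<in> rectangle p t a b" unfolding rectangle_def by blast
  ultimately show "z \<in> (\<lambda>y. x + l *\<^sub>R y) ` rectangle p t a b" by blast
qed

lemma rectangle_basis_homothecy_invariant: "homothecy_invariant (rectangle_basis \<Theta> shape)"
  unfolding homothecy_invariant_def
proof (intro ballI allI impI)
  fix B x and l :: real assume B: "B \<in> rectangle_basis \<Theta> shape" and l: "l > 0"
  obtain p t a b where r: "B = rectangle p t a b" "t \<in> \<Theta>" "0 < b" "b \<le> a" "a / b = shape t"
    using B by (auto simp: rectangle_basis_def)
  have "(\<lambda>y. x + l *\<^sub>R y) ` B = rectangle (x + l *\<^sub>R p) t (l * a) (l * b)"
    using rectangle_homothecy[OF l] r by simp
  moreover have "0 < l * b" "l * b \<le> l * a" "(l * a) / (l * b) = shape t" using r l by auto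
  ultimately show "(\<lambda>y. x + l *\<^sub>R y) ` B \<in> rectangle_basis \<Theta> shape"
    unfolding rectangle_basis_def using r by blast
qed

lemma orlicz_space_subset_L1_loc:
  assumes "young_function \<Phi>"
  shows "orlicz_space \<Phi> \<subseteq> L1_loc"
proof
  fix f assume "f \<in> orlicz_space \<Phi>"
  then obtain \<mu> where f: "f \<in> borel_measurable lebesgue" and \<mu>: "\<mu> > 0"
    and fin: "(\<integral>\<^sup>+x. ennreal (\<Phi> (\<bar>f x\<bar> / \<mu>)) \<partial>lebesgue) < \<infinity>"
    by (auto simp: orlicz_space_def)
  obtain s where s: "s \<ge> 0" "\<Phi> s \<noteq> 0" using assms by (auto simp: young_function_def)
  have s0: "s > 0" "\<Phi> s > 0"
    using s assms by (auto simp: young_function_def less_le)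
  define c where "c = s / \<Phi> s"
  have c: "c > 0" using s0 by (simp add: c_def)
  have lin: "t \<le> s + c * \<Phi> t" if "t \<ge> 0" for t
  proof (cases "t \<le> s")
    case True
    moreover have "0 \<le> c * \<Phi> t" using assms that c by (simp add: young_function_def)
    ultimately show ?thesis by linarith
  next
    case False
    have cv: "convex_on {0..} \<Phi>" and z: "\<Phi> 0 = 0" using assms by (auto simp: young_function_def)
    have "\<Phi> ((1 - s / t) *\<^sub>R 0 + (s / t) *\<^sub>R t) \<le> (1 - s / t) * \<Phi> 0 + (s / t) * \<Phi> t"
      using False s0 by (intro convex_onD[OF cv]) auto
    then have "\<Phi> s \<le> (s / t) * \<Phi> t" using z False s0 by simp
    then have "t \<le> c * \<Phi> t" using False s0 by (simp add: c_def field_simps)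
    then show ?thesis using s0 by simp
  qed
  show "f \<in> L1_loc"
    unfolding L1_loc_def
  proof (intro CollectI allI impI)
    fix K :: "(real^2) set" assume K: "compact K"
    have Km: "K \<in> sets lebesgue" "emeasure lebesgue K < \<infinity>"
      using K lmeasurable_compact[of K] by (auto simp: fmeasurable_def)
    have "mono (\<lambda>t. \<Phi> (max 0 t))"
      using assms by (auto simp: young_function_def mono_on_def intro!: monoI)
    then have "(\<lambda>t. \<Phi> (max 0 t)) \<in> borel_measurable borel"
      by (rule borel_measurable_mono)
    then have "(\<lambda>x. \<Phi> (max 0 (\<bar>f x\<bar> / \<mu>))) \<in> borel_measurable lebesgue"
      by (rule measurable_compose[rotated]) (use f in measurable)
    moreover have "max 0 (\<bar>f x\<bar> / \<mu>) = \<bar>f x\<bar> / \<mu>" for x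
      using \<mu> by (simp add: max_def)
    ultimately have m: "(\<lambda>x. \<Phi> (\<bar>f x\<bar> / \<mu>)) \<in> borel_measurable lebesgue"
      by simp
    have pt: "ennreal (norm (indicator K x *\<^sub>R f x))
        \<le> ennreal (\<mu> * s) * indicator K x + ennreal (\<mu> * c) * ennreal (\<Phi> (\<bar>f x\<bar> / \<mu>))" for x
    proof (cases "x \<in> K")
      case True
      have "\<bar>f x\<bar> / \<mu> \<le> s + c * \<Phi> (\<bar>f x\<bar> / \<mu>)" using lin[of "\<bar>f x\<bar> / \<mu>"] \<mu> by simp
      then have "\<bar>f x\<bar> \<le> \<mu> * s + \<mu> * c * \<Phi> (\<bar>f x\<bar> / \<mu>)"
        using \<mu> by (simp add: pos_divide_le_eq algebra_simps)
      moreover have "0 \<le> \<Phi> (\<bar>f x\<bar> / \<mu>)" using assms \<mu> by (simp add: young_function_def)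
      ultimately show ?thesis
        using True \<mu> c s0 by (simp add: ennreal_leI flip: ennreal_mult ennreal_plus)
    qed simp
    have "(\<integral>\<^sup>+x. ennreal (norm (indicator K x *\<^sub>R f x)) \<partial>lebesgue)
        \<le> (\<integral>\<^sup>+x. (ennreal (\<mu> * s) * indicator K x +
             ennreal (\<mu> * c) * ennreal (\<Phi> (\<bar>f x\<bar> / \<mu>))) \<partial>lebesgue)"
      using pt by (rule nn_integral_mono)
    also have "\<dots> = ennreal (\<mu> * s) * emeasure lebesgue K +
        ennreal (\<mu> * c) * (\<integral>\<^sup>+x. ennreal (\<Phi> (\<bar>f x\<bar> / \<mu>)) \<partial>lebesgue)"
      using m Km by (simp add: nn_integral_add nn_integral_cmult nn_integral_cmult_indicator)
    also have "\<dots> < \<infinity>"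
      using Km fin by (simp add: ennreal_mult_less_top)
    finally show "set_integrable lebesgue K f"
      unfolding set_integrable_def using f Km by (intro integrableI_bounded) auto
  qed
qed

end

theory Submission
  imports Defs
begin

text \<open>
  For fixed \<open>k\<close>, the \<open>N\<^sub>k\<close> rectangles of size \<open>\<sigma>\<^sub>k b \<times> b\<close> with a common vertex and directions
  \<open>\<theta>\<^sub>k\<^sub>+\<^sub>1 + (i - 1) \<delta>\<^sub>k\<close> have disjoint outer halves because \<open>sin \<delta>\<^sub>k \<ge> 4 / \<sigma>\<^sub>k\<close>, so their union, the fan,
  has area at least \<open>N\<^sub>k \<sigma>\<^sub>k b\<^sup>2 / 2\<close>. On each of them the function equal to \<open>\<sigma>\<^sub>k\<close> on a square of side \<open>4 b\<close>
  around the vertex has average at least \<open>1\<close>. By an averaging argument, translates of an arbitrarily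
  small fan, of bounded total area, cover half of the unit square; the corresponding squares
  have total area \<open>O(1 / (N\<^sub>k \<sigma>\<^sub>k))\<close>. If \<open>N\<^sub>k \<sigma>\<^sub>k\<close> is not \<open>O(\<Phi>(\<sigma>\<^sub>k))\<close>, superpose these functions along a
  subsequence on which \<open>N\<^sub>k \<sigma>\<^sub>k \<ge> 4000 \<sqdot> 2\<^sup>j\<close> and \<open>N\<^sub>k \<sigma>\<^sub>k \<ge> 2\<^sup>j \<Phi>(\<sigma>\<^sub>k)\<close>: their supremum \<open>f\<close> lies in
  \<open>L\<^sup>\<Phi>\<close> and vanishes outside a set of measure less than \<open>1/2\<close>, while a set of measure at least \<open>1/2\<close> lies in
  infinitely many of the covers, which forces the upper limit of the averages of \<open>f\<close> to be at least \<open>1\<close> there.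
\<close>

section \<open>Covering by translates\<close>

text \<open>By Tonelli, the left side integrates over \<open>y\<close> in \<open>A\<close> the
  measure of the set of all \<open>x\<close> with \<open>y - x\<close> in \<open>F\<close>. That set
  is the image of \<open>F\<close> under the measure-preserving map from \<open>z\<close> to
  \<open>y - z\<close>.\<close>

lemma nn_integral_emeasure_Int_translate:
  fixes A F :: "'a::euclidean_space set"
  assumes [measurable]: "A \<in> sets borel" "F \<in> sets borel"
  shows "(\<integral>\<^sup>+x. emeasure lborel (A \<inter> (+) x ` F) \<partial>lborel) = emeasure lborel A * emeasure lborel F"
proof -
  have tr: "(+) x ` F = {y. y - x \<in> F}" for x
    by (auto intro!: image_eqI[where x="y - x" for y])
  have m: "(\<lambda>z. indicator A (snd z) * indicator F (snd z - fst z) :: ennreal)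
      \<in> borel_measurable (lborel \<Otimes>\<^sub>M lborel)" by measurable
  have "(\<integral>\<^sup>+x. emeasure lborel (A \<inter> (+) x ` F) \<partial>lborel)
      = (\<integral>\<^sup>+x. \<integral>\<^sup>+y. indicator A y * indicator F (y - x) \<partial>lborel \<partial>lborel)"
  proof (rule nn_integral_cong)
    fix x :: 'a
    have "{y. y - x \<in> F} \<in> sets borel" by measurable
    then have "emeasure lborel (A \<inter> (+) x ` F) = (\<integral>\<^sup>+y. indicator (A \<inter> {y. y - x \<in> F}) y \<partial>lborel)"
      by (simp add: tr)
    also have "\<dots> = (\<integral>\<^sup>+y. indicator A y * indicator F (y - x) \<partial>lborel)"
      by (intro nn_integral_cong) (auto simp: indicator_def)
    finally show "emeasure lborel (A \<inter> (+) x ` F)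
      = (\<integral>\<^sup>+y. indicator A y * indicator F (y - x) \<partial>lborel)" .
  qed
  also have "\<dots> = (\<integral>\<^sup>+y. \<integral>\<^sup>+x. indicator A y * indicator F (y - x) \<partial>lborel \<partial>lborel)"
    using lborel_pair.Fubini'[of "\<lambda>x y. indicator A y * indicator F (y - x)"] m
    by (simp add: case_prod_unfold)
  also have "\<dots> = (\<integral>\<^sup>+y. indicator A y * emeasure lborel F \<partial>lborel)"
  proof (rule nn_integral_cong)
    fix y :: 'a
    have "(\<integral>\<^sup>+x. indicator F x \<partial>lborel) = (\<integral>\<^sup>+x. indicator F (y - x) \<partial>lborel)"
      by (subst lborel_affine[of "-1" y]) (simp_all add: nn_integral_density nn_integral_distr)
    then show "(\<integral>\<^sup>+x. indicator A y * indicator F (y - x) \<partial>lborel)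
        = indicator A y * emeasure lborel F"
      by (simp add: nn_integral_cmult)
  qed
  also have "\<dots> = emeasure lborel A * emeasure lborel F"
    by (simp add: nn_integral_multc)
  finally show ?thesis .
qed

text \<open>The factor 2 keeps the contradiction strict without discussing almost everywhere equality.\<close>

lemma exists_large_Int_translate:
  fixes A F P :: "'a::euclidean_space set"
  assumes A: "A \<in> fmeasurable lborel" and F: "F \<in> fmeasurable lborel" and P: "P \<in> fmeasurable lborel"
    and window: "\<And>x. A \<inter> (+) x ` F \<noteq> {} \<Longrightarrow> x \<in> P"
    and pos: "0 < measure lborel P"
  shows "\<exists>x. measure lborel A * measure lborel F / (2 * measure lborel P)
           \<le> measure lborel (A \<inter> (+) x ` F)"
proof (rule ccontr)
  let ?m = "measure lborel"
  define c where "c = ?m A * ?m F / (2 * ?m P)"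
  assume "\<not> ?thesis"
  then have less: "?m (A \<inter> (+) x ` F) < c" for x by (auto simp: not_le c_def)
  have ms: "A \<in> sets borel" "F \<in> sets borel" "P \<in> sets borel"
    using A F P by (auto simp: fmeasurable_def)
  have em: "emeasure lborel (A \<inter> (+) x ` F) = ennreal (?m (A \<inter> (+) x ` F))" for x
  proof (rule emeasure_eq_ennreal_measure)
    have "emeasure lborel (A \<inter> (+) x ` F) \<le> emeasure lborel A"
      using ms by (intro emeasure_mono) auto
    then show "emeasure lborel (A \<inter> (+) x ` F) \<noteq> top"
      using A by (auto simp: fmeasurable_def top_unique)
  qed
  \<comment> \<open>A nonnegative measure lies strictly below \<open>c\<close>, so \<open>A\<close>
    and \<open>F\<close> have positive measure; the final inequality, which bounds the product of
    their measures by half of itself, is then absurd.\<close>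
  have c: "0 < c" using less[of 0] measure_nonneg[of lborel] by (rule order.strict_trans1[rotated])
  have "ennreal (?m A * ?m F) = emeasure lborel A * emeasure lborel F"
    using A F by (simp add: emeasure_eq_measure2 ennreal_mult)
  also have "\<dots> = (\<integral>\<^sup>+x. emeasure lborel (A \<inter> (+) x ` F) \<partial>lborel)"
    by (rule nn_integral_emeasure_Int_translate[OF ms(1,2), symmetric])
  \<comment> \<open>The assumption \<open>window\<close> confines the integrand to \<open>P\<close>,
    where it is at most \<open>c\<close>.\<close>
  also have "\<dots> \<le> (\<integral>\<^sup>+x. ennreal c * indicator P x \<partial>lborel)"
  proof (rule nn_integral_mono)
    fix x
    show "emeasure lborel (A \<inter> (+) x ` F) \<le> ennreal c * indicator P x"
      using less[of x] window[of x] by (cases "A \<inter> (+) x ` F = {}") (auto simp: em intro!: ennreal_leI)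
  qed
  also have "\<dots> = ennreal (c * ?m P)"
    using P ms c by (simp add: nn_integral_cmult_indicator emeasure_eq_measure2 ennreal_mult)
  finally have "?m A * ?m F \<le> c * ?m P"
    using c pos by simp
  also have "c * ?m P = ?m A * ?m F / 2" using pos by (simp add: c_def)
  finally show False
    using c pos measure_nonneg[of lborel A] measure_nonneg[of lborel F]
    by (auto simp: c_def zero_less_divide_iff)
qed

text \<open>Averaging provides a translate that captures a share \<open>p\<close>, half the ratio of
  the measures of \<open>F\<close> and \<open>P\<close>, of what is still uncovered. At most
  \<open>1 - p \<le> exp (- p)\<close> of it remains, and iteration gives geometric decay.\<close>

lemma greedy_translate_cover:
  fixes Q F P :: "'a::euclidean_space set"
  assumes Q: "Q \<in> fmeasurable lborel" and F: "F \<in> fmeasurable lborel" and P: "P \<in> fmeasurable lborel"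
    and window: "\<And>x. Q \<inter> (+) x ` F \<noteq> {} \<Longrightarrow> x \<in> P"
    and pos: "0 < measure lborel P"
  shows "\<exists>X. finite X \<and> card X \<le> n \<and>
     measure lborel (Q - (\<Union>x\<in>X. (+) x ` F))
       \<le> exp (- (measure lborel F / (2 * measure lborel P))) ^ n * measure lborel Q"
proof (induction n)
  case 0
  show ?case by (intro exI[of _ "{}"]) simp
next
  case (Suc n)
  define p where "p = measure lborel F / (2 * measure lborel P)"
  obtain X where X: "finite X" "card X \<le> n"
    "measure lborel (Q - (\<Union>x\<in>X. (+) x ` F)) \<le> exp (- p) ^ n * measure lborel Q"
    using Suc by (auto simp: p_def)
  have F': "(+) x ` F \<in> sets borel" for x
  proof -
    have "(+) x ` F = (\<lambda>y. y - x) -` F \<inter> space borel"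
      by (auto intro!: image_eqI[where x="y - x" for y])
    also have "\<dots> \<in> sets borel"
      using F by (intro measurable_sets[of _ borel borel]) (auto simp: fmeasurable_def)
    finally show ?thesis .
  qed
  define A where "A = Q - (\<Union>x\<in>X. (+) x ` F)"
  have A: "A \<in> fmeasurable lborel"
    unfolding A_def using Q F' X by (intro fmeasurable_Diff) auto
  \<comment> \<open>The remainder \<open>A\<close> is contained in \<open>Q\<close>, so the same
    \<open>P\<close> serves at every stage.\<close>
  have "x \<in> P" if "A \<inter> (+) x ` F \<noteq> {}" for x
    using that by (intro window) (auto simp: A_def)
  then obtain x where x: "measure lborel A * p \<le> measure lborel (A \<inter> (+) x ` F)"
    using exists_large_Int_translate[OF A F P _ pos] by (auto simp: p_def)
  have "measure lborel (Q - (\<Union>x\<in>insert x X. (+) x ` F)) = measure lborel (A - (A \<inter> (+) x ` F))"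
    by (rule arg_cong[of _ _ "measure lborel"]) (auto simp: A_def)
  also have "\<dots> = measure lborel A - measure lborel (A \<inter> (+) x ` F)"
    using A F' by (intro measurable_measure_Diff) (auto intro: fmeasurable_Int_fmeasurable)
  also have "\<dots> \<le> (1 - p) * measure lborel A" using x by (simp add: algebra_simps)
  also have "\<dots> \<le> exp (- p) * measure lborel A"
    using exp_ge_add_one_self[of "- p"] by (intro mult_right_mono) auto
  also have "\<dots> \<le> exp (- p) * (exp (- p) ^ n * measure lborel Q)"
    using X by (intro mult_left_mono) (auto simp: A_def)
  also have "\<dots> = exp (- p) ^ Suc n * measure lborel Q" by simp
  finally show ?case
    using X unfolding p_def by (intro exI[of _ "insert x X"]) (auto simp: card_insert_if)
qed

text \<open>After \<open>2 * v / f\<close> greedy steps the total exponent reaches 1, and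
  \<open>exp (-1) \<le> 1 / 2\<close>. Rounding up to an integer adds at most the measure of
  \<open>F\<close>, hence of \<open>P\<close>, which turns the factor 2 into 3.\<close>

lemma half_translate_cover:
  fixes Q F P :: "'a::euclidean_space set"
  assumes Q: "Q \<in> fmeasurable lborel" and F: "F \<in> fmeasurable lborel" and P: "P \<in> fmeasurable lborel"
    and window: "\<And>x. Q \<inter> (+) x ` F \<noteq> {} \<Longrightarrow> x \<in> P"
    and pos: "0 < measure lborel F" "measure lborel F \<le> measure lborel P"
  obtains X where "finite X" "real (card X) * measure lborel F \<le> 3 * measure lborel P"
    "measure lborel (Q - (\<Union>x\<in>X. (+) x ` F)) \<le> measure lborel Q / 2"
proof -
  define f v where "f = measure lborel F" and "v = measure lborel P"
  define n where "n = nat \<lceil>2 * v / f\<rceil>"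
  have fv: "0 < f" "f \<le> v" using pos by (auto simp: f_def v_def)
  obtain X where X: "finite X" "card X \<le> n"
    "measure lborel (Q - (\<Union>x\<in>X. (+) x ` F)) \<le> exp (- (f / (2 * v))) ^ n * measure lborel Q"
    using greedy_translate_cover[OF Q F P window, of n] pos by (auto simp: f_def v_def)
  have n: "2 * v / f \<le> real n" "real n \<le> 2 * v / f + 1" using fv by (auto simp: n_def)
  have "real (card X) * f \<le> (2 * v / f + 1) * f"
    using X n fv by (intro mult_right_mono) auto
  also have "\<dots> = 2 * v + f" using fv by (simp add: field_simps)
  finally have card: "real (card X) * f \<le> 3 * v" using fv by simp
  have "1 \<le> real n * (f / (2 * v))" using n fv by (simp add: field_simps)
  then have "exp (- (f / (2 * v))) ^ n \<le> exp (-1)"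
    by (simp flip: exp_of_nat_mult)
  also have "\<dots> \<le> 1 / 2"
    using exp_ge_add_one_self[of 1] by (simp add: exp_minus field_simps)
  finally have "exp (- (f / (2 * v))) ^ n * measure lborel Q \<le> 1 / 2 * measure lborel Q"
    by (rule mult_right_mono) auto
  then show thesis using X card that by (auto simp: f_def v_def)
qed

section \<open>Fans of rectangles\<close>

text \<open>The rectangle arises from an axis-parallel box by a rotation and a translation, both of
  which preserve Lebesgue measure.\<close>

lemma measure_rectangle:
  assumes "0 \<le> a" "0 \<le> b"
  shows "measure lborel (rectangle p t a b) = a * b"
proof -
  define f :: "real^2 \<Rightarrow> real^2" where
    "f z = (z $ 1) *\<^sub>R vector [cos t, sin t] + (z $ 2) *\<^sub>R vector [- sin t, cos t]" for z
  have lin: "linear f"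
    by (rule linearI) (simp_all add: f_def algebra_simps)
  have "f x \<bullet> f y = x \<bullet> y" for x y
  proof -
    have "(x1 * cos t - x2 * sin t) * (y1 * cos t - y2 * sin t) +
      (x1 * sin t + x2 * cos t) * (y1 * sin t + y2 * cos t) = x1 * y1 + x2 * y2" for x1 x2 y1 y2 :: real
      using sin_cos_squared_add[of t] by algebra
    then show ?thesis by (simp add: f_def inner_vec_def sum_2)
  qed
  then have orth: "orthogonal_transformation f"
    using lin by (simp add: orthogonal_transformation_def)
  have eq: "rectangle p t a b = (+) p ` f ` box 0 (vector [a, b])"
  proof (intro set_eqI iffI)
    fix z assume "z \<in> rectangle p t a b"
    then obtain u v where uv: "0 < u" "u < a" "0 < v" "v < b"
      "z = p + u *\<^sub>R vector [cos t, sin t] + v *\<^sub>R vector [- sin t, cos t]"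
      unfolding rectangle_def by auto
    then have "z = p + f (vector [u, v])" by (simp add: f_def add.assoc)
    moreover have "vector [u, v] \<in> box 0 (vector [a, b] :: real^2)"
      using uv by (simp add: mem_box_cart forall_2)
    ultimately show "z \<in> (+) p ` f ` box 0 (vector [a, b])" by blast
  next
    fix z assume "z \<in> (+) p ` f ` box 0 (vector [a, b])"
    then obtain w where "w \<in> box 0 (vector [a, b] :: real^2)" "z = p + f w" by auto
    then show "z \<in> rectangle p t a b"
      unfolding rectangle_def mem_Collect_eq
      by (intro exI[of _ "w $ 1"] exI[of _ "w $ 2"]) (auto simp: f_def mem_box_cart forall_2)
  qed
  have "measure lebesgue (box 0 (vector [a, b] :: real^2)) = measure lebesgue (cbox 0 (vector [a, b] :: real^2))"
    by (simp add: measure_lborel_box_eq measure_lborel_cbox_eq)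
  also have "\<dots> = a * b"
  proof -
    have "cbox 0 (vector [a, b] :: real^2) \<noteq> {}"
      using assms by (simp add: interval_ne_empty_cart forall_2)
    then show ?thesis by (simp add: content_cbox_cart UNIV_2)
  qed
  finally have "measure lebesgue (rectangle p t a b) = a * b"
    using measure_orthogonal_image[OF orth, of "box 0 (vector [a, b])"]
    by (simp add: eq measure_translation)
  then show ?thesis using open_rectangle by (simp add: borel_open)
qed

lemma fmeasurable_rectangle: "rectangle p t a b \<in> fmeasurable lborel"
  using open_rectangle bounded_rectangle
  by (auto intro!: fmeasurableI emeasure_bounded_finite borel_open simp: less_top)

lemma rectangle_mono: "a \<le> a' \<Longrightarrow> b \<le> b' \<Longrightarrow> rectangle p t a b \<subseteq> rectangle p t a' b'"
  unfolding rectangle_eq by auto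

lemma translate_rectangle: "(+) x ` rectangle p t a b = rectangle (x + p) t a b"
  using rectangle_homothecy[of 1 x p t a b] by (simp add: image_def)

text \<open>The bound does not depend on \<open>t\<close>: with \<open>a = b\<close> it puts the end
  squares of all rectangles of a fan into one axis-parallel square.\<close>

lemma rectangle_subset_cbox:
  "rectangle p t a b \<subseteq> cbox (p - (\<chi> i. a + b)) (p + (\<chi> i. a + b))"
proof
  fix x assume "x \<in> rectangle p t a b"
  then have "norm (x - p) \<le> a + b" by (rule dist_rectangle)
  then have "\<bar>(x - p) $ i\<bar> \<le> a + b" for i
    using component_le_norm_cart[of "x - p" i] by linarith
  then show "x \<in> cbox (p - (\<chi> i. a + b)) (p + (\<chi> i. a + b))"
    by (auto simp: mem_box_cart abs_le_iff algebra_simps)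
qed

text \<open>These are the outer halves of two rectangles with a vertex at the origin. The line
  through the origin in direction \<open>t\<close> separates them: the second lies on its positive
  side, the first on its negative side.\<close>

lemma outer_rectangles_disjoint:
  assumes ab: "0 < a" "0 < b" and st: "t - s < pi" "0 < t - s" "2 * b \<le> a * sin (t - s)"
  shows "rectangle ((a/2) *\<^sub>R vector [cos s, sin s]) s (a/2) b \<inter>
         rectangle ((a/2) *\<^sub>R vector [cos t, sin t]) t (a/2) b = {}"
proof (rule ccontr)
  assume "\<not> ?thesis"
  then obtain x where x: "x \<in> rectangle ((a/2) *\<^sub>R vector [cos s, sin s]) s (a/2) b"
    "x \<in> rectangle ((a/2) *\<^sub>R vector [cos t, sin t]) t (a/2) b" by blast
  obtain u v where uv: "0 < u" "0 < v" "v < b"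
    "x = (a/2 + u) *\<^sub>R vector [cos s, sin s] + v *\<^sub>R vector [- sin s, cos s]"
    using x(1) unfolding rectangle_def by (auto simp: algebra_simps)
  obtain u' v' where uv': "0 < v'"
    "x = (a/2 + u') *\<^sub>R vector [cos t, sin t] + v' *\<^sub>R vector [- sin t, cos t]"
    using x(2) unfolding rectangle_def by (auto simp: algebra_simps)
  have "v' * (cos t * cos t) + v' * (sin t * sin t) = v'"
    by (simp flip: distrib_left)
  then have "x \<bullet> vector [- sin t, cos t] = v'"
    unfolding uv'(2) by (simp add: inner_vec_def sum_2 algebra_simps)
  then have "0 < x \<bullet> vector [- sin t, cos t]" using uv' by simp
  also have "x \<bullet> vector [- sin t, cos t] = - (a/2 + u) * sin (t - s) + v * cos (t - s)"
    unfolding uv(4) by (simp add: inner_vec_def sum_2 algebra_simps sin_diff cos_diff)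
  \<comment> \<open>Going out by more than \<open>a/2\<close> in direction \<open>s\<close> lowers
    the coordinate normal to \<open>t\<close> by more than \<open>b\<close>, while the width of the
    rectangle raises it by less than \<open>b\<close>.\<close>
  also have "\<dots> < 0"
  proof -
    have "v * cos (t - s) \<le> v" using uv by (simp add: mult_left_le)
    moreover have "0 < u * sin (t - s)" using uv st by (simp add: sin_gt_zero)
    moreover have "- (a/2 + u) * sin (t - s) = - (a * sin (t - s) / 2) - u * sin (t - s)"
      by (simp add: algebra_simps)
    ultimately show ?thesis using uv(3) st(3) by linarith
  qed
  finally show False .
qed

text \<open>The outer halves are pairwise disjoint and each has area \<open>a * b / 2\<close>; the
  inner halves may overlap near the common vertex and are discarded.\<close>

lemma measure_rectangle_fan:
  assumes T: "finite T" and ab: "0 < a" "0 < b"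
    and sep: "\<And>s t. s \<in> T \<Longrightarrow> t \<in> T \<Longrightarrow> s < t \<Longrightarrow> t - s < pi \<and> 2 * b \<le> a * sin (t - s)"
  shows "real (card T) * (a * b / 2) \<le> measure lborel (\<Union>t\<in>T. rectangle 0 t a b)"
proof -
  define H where "H t = rectangle ((a/2) *\<^sub>R vector [cos t, sin t]) t (a/2) b" for t
  have sub: "H t \<subseteq> rectangle 0 t a b" for t
  proof
    fix x assume "x \<in> H t"
    then obtain u v where "0 < u" "u < a/2" "0 < v" "v < b"
      "x = (a/2) *\<^sub>R vector [cos t, sin t] + u *\<^sub>R vector [cos t, sin t] + v *\<^sub>R vector [- sin t, cos t]"
      unfolding H_def rectangle_def by auto
    then show "x \<in> rectangle 0 t a b"
      unfolding rectangle_def mem_Collect_eq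
      by (intro exI[of _ "a/2 + u"] exI[of _ v]) (auto simp: algebra_simps)
  qed
  have "disjoint_family_on H T"
    unfolding disjoint_family_on_def
  proof (intro ballI impI)
    fix s t assume st: "s \<in> T" "t \<in> T" "s \<noteq> t"
    then consider "s < t" | "t < s" by linarith
    then show "H s \<inter> H t = {}"
    proof cases
      case 1
      then show ?thesis unfolding H_def using sep[OF st(1,2)] ab
        by (intro outer_rectangles_disjoint) auto
    next
      case 2
      then have "H t \<inter> H s = {}" unfolding H_def using sep[OF st(2,1)] ab
        by (intro outer_rectangles_disjoint) auto
      then show ?thesis by blast
    qed
  qed
  then have "measure lborel (\<Union>t\<in>T. H t) = (\<Sum>t\<in>T. measure lborel (H t))"
    using T by (intro measure_UNION' )
      (auto simp: H_def fmeasurable_rectangle disjoint_family_on_def pairwise_def disjnt_def)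
  also have "\<dots> = real (card T) * (a * b / 2)"
    using ab by (simp add: H_def measure_rectangle)
  finally have "real (card T) * (a * b / 2) = measure lborel (\<Union>t\<in>T. H t)" by simp
  also have "\<dots> \<le> measure lborel (\<Union>t\<in>T. rectangle 0 t a b)"
    using sub T by (intro measure_mono_fmeasurable fmeasurable.finite_UN)
      (auto simp: H_def fmeasurable_rectangle intro: fmeasurableD[OF fmeasurable_rectangle, simplified])
  finally show ?thesis .
qed

lemma fmeasurable_cbox_lborel: "cbox a b \<in> fmeasurable lborel"
  by (intro fmeasurableI emeasure_bounded_finite) auto

text \<open>The construction at one scale: \<open>A\<close> is the part of the unit square covered
  by translated fans, and \<open>E\<close> consists of squares around their vertices. The constant
  is \<open>32 * 27\<close>: a square has area \<open>16 * (b * b)\<close>, which is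
  \<open>32 / \<sigma>\<close> times \<open>a * b / 2\<close>, and the fans have total area at most
  three times the area 9 of \<open>P\<close>.\<close>

lemma fan_translates:
  fixes T :: "real set"
  assumes T: "finite T" "T \<noteq> {}" and \<sigma>: "4 \<le> \<sigma>" and e: "0 < e" "e \<le> 1"
    and sep: "\<And>s t. s \<in> T \<Longrightarrow> t \<in> T \<Longrightarrow> s < t \<Longrightarrow> t - s < pi \<and> 4 / \<sigma> \<le> sin (t - s)"
  shows "\<exists>E A. E \<in> fmeasurable lborel \<and> measure lborel E * (real (card T) * \<sigma>) \<le> 864 \<and>
     A \<in> sets borel \<and> A \<subseteq> cbox 0 (\<chi> i. 1) \<and> 1 / 2 \<le> measure lborel A \<and>
     (\<forall>x\<in>A. \<exists>B p t a b. B = rectangle p t a b \<and> t \<in> T \<and> 0 < b \<and> b \<le> a \<and> a / b = \<sigma> \<and>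
        x \<in> B \<and> diameter B < e \<and> 0 < measure lborel B \<and>
        measure lborel B \<le> \<sigma> * measure lborel (B \<inter> E))"
proof -
  \<comment> \<open>This size makes the diameters at most \<open>4 * a = e / 2\<close> and keeps the
    fan within distance 1 of its vertex.\<close>
  define a b where "a = e / 8" and "b = a / \<sigma>"
  have ab: "0 < a" "0 < b" "b \<le> a" "a / b = \<sigma>" "a = \<sigma> * b" "a \<le> 1 / 8" "4 * a < e"
    using e \<sigma> by (auto simp: a_def b_def field_simps)
  define F where "F = (\<Union>t\<in>T. rectangle 0 t a b)"
  \<comment> \<open>\<open>P\<close> is \<open>Q\<close> enlarged by 1 in every coordinate
    direction, enough to contain each \<open>x\<close> for which the fan translated by
    \<open>x\<close> meets \<open>Q\<close>.\<close>
  define Q P :: "(real^2) set" where "Q = cbox 0 (\<chi> i. 1)" and "P = cbox (\<chi> i. -1) (\<chi> i. 2)"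
  have meas: "Q \<in> fmeasurable lborel" "P \<in> fmeasurable lborel"
    by (simp_all add: Q_def P_def fmeasurable_cbox_lborel)
  have F: "F \<in> fmeasurable lborel"
    unfolding F_def using T fmeasurable_rectangle by (intro fmeasurable.finite_UN) auto
  have mQ: "measure lborel Q = 1"
    unfolding Q_def by (subst content_cbox_cart) (auto simp: interval_ne_empty_cart)
  have mP: "measure lborel P = 9"
    unfolding P_def by (subst content_cbox_cart) (auto simp: interval_ne_empty_cart UNIV_2)
  have F_bound: "\<bar>y $ i\<bar> \<le> 1" if yF: "y \<in> F" for y i
  proof -
    obtain t where "y \<in> rectangle 0 t a b" using yF by (auto simp: F_def)
    then have "norm y \<le> a + b" using dist_rectangle[of y 0 t a b] by simp
    then show ?thesis using component_le_norm_cart[of y i] ab by linarith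
  qed
  have "F \<subseteq> P" using F_bound by (auto simp: P_def mem_box_cart abs_le_iff) (smt (verit))+
  then have FP: "measure lborel F \<le> measure lborel P"
    using F meas by (intro measure_mono_fmeasurable) (auto simp: fmeasurable_def)
  have window: "x \<in> P" if ne: "Q \<inter> (+) x ` F \<noteq> {}" for x
  proof -
    obtain y where y: "y \<in> F" "x + y \<in> Q" using ne by auto
    then have "\<bar>y $ i\<bar> \<le> 1" "0 \<le> x $ i + y $ i" "x $ i + y $ i \<le> 1" for i
      using F_bound by (auto simp: Q_def mem_box_cart)
    then have "-1 \<le> x $ i \<and> x $ i \<le> 2" for i by (smt (verit))
    then show ?thesis by (auto simp: P_def mem_box_cart)
  qed
  have F_ge: "real (card T) * (a * b / 2) \<le> measure lborel F"
    unfolding F_def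
  proof (rule measure_rectangle_fan)
    fix s t assume st: "s \<in> T" "t \<in> T" "s < t"
    have "2 * b \<le> a * (4 / \<sigma>)" using ab \<sigma> by simp
    also have "\<dots> \<le> a * sin (t - s)" using sep[OF st] ab by (intro mult_left_mono) auto
    finally show "t - s < pi \<and> 2 * b \<le> a * sin (t - s)" using sep[OF st] by simp
  qed (use T ab in auto)
  have cT: "0 < card T" using T by (simp add: card_gt_0_iff)
  have F_pos: "0 < measure lborel F"
  proof -
    have "0 < real (card T) * (a * b / 2)" using cT ab by simp
    then show ?thesis using F_ge by linarith
  qed
  obtain X where X: "finite X" "real (card X) * measure lborel F \<le> 3 * measure lborel P"
    "measure lborel (Q - (\<Union>x\<in>X. (+) x ` F)) \<le> measure lborel Q / 2"
    using half_translate_cover[OF meas(1) F meas(2) window F_pos FP] by blast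
  \<comment> \<open>A single square of side \<open>4 * b\<close> serves all \<open>card T\<close>
    rectangles of a fan; this is where the factor \<open>card T\<close> in the estimate for
    \<open>E\<close> is gained.\<close>
  define C where "C x = cbox (x - (\<chi> i. b + b)) (x + (\<chi> i. b + b))" for x :: "real^2"
  define E where "E = (\<Union>x\<in>X. C x)"
  define A where "A = Q \<inter> (\<Union>x\<in>X. (+) x ` F)"
  have C: "C x \<in> fmeasurable lborel" "measure lborel (C x) = 16 * (b * b)" for x
    using ab unfolding C_def
    by (auto simp: fmeasurable_cbox_lborel content_cbox_cart interval_ne_empty_cart UNIV_2 algebra_simps)
  have E: "E \<in> fmeasurable lborel" unfolding E_def using X C by (intro fmeasurable.finite_UN) auto
  have "measure lborel E \<le> (\<Sum>x\<in>X. measure lborel (C x))"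
    unfolding E_def using X(1) C(1) by (intro measure_UNION_le) (auto simp: fmeasurable_def)
  then have "measure lborel E \<le> real (card X) * (16 * (b * b))" by (simp add: C)
  then have "measure lborel E * (real (card T) * \<sigma>) \<le> real (card X) * (16 * (b * b)) * (real (card T) * \<sigma>)"
    using \<sigma> by (intro mult_right_mono) auto
  also have "\<dots> = 32 * (real (card X) * (real (card T) * (a * b / 2)))" by (simp add: ab(5))
  also have "\<dots> \<le> 32 * (real (card X) * measure lborel F)"
    using F_ge by (intro mult_left_mono) auto
  finally have E_le: "measure lborel E * (real (card T) * \<sigma>) \<le> 864" using X(2) mP by simp
  have xF: "(+) x ` F = (\<Union>t\<in>T. rectangle x t a b)" for x
    by (simp add: F_def image_UN translate_rectangle)
  have U: "(\<Union>x\<in>X. (+) x ` F) \<in> sets borel"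
    by (auto simp: xF intro!: borel_open open_rectangle)
  have A: "A \<in> sets borel" unfolding A_def using meas U by (auto simp: fmeasurable_def)
  have "measure lborel (Q - (\<Union>x\<in>X. (+) x ` F)) = measure lborel Q - measure lborel A"
  proof -
    have "Q - (\<Union>x\<in>X. (+) x ` F) = Q - A" by (auto simp: A_def)
    moreover have "measure lborel (Q - A) = measure lborel Q - measure lborel A"
      using meas A by (intro measurable_measure_Diff) (auto simp: A_def)
    ultimately show ?thesis by simp
  qed
  then have A_ge: "1 / 2 \<le> measure lborel A" using X(3) mQ by simp
  have "\<exists>B p t a b. B = rectangle p t a b \<and> t \<in> T \<and> 0 < b \<and> b \<le> a \<and> a / b = \<sigma> \<and>
        x \<in> B \<and> diameter B < e \<and> 0 < measure lborel B \<and>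
        measure lborel B \<le> \<sigma> * measure lborel (B \<inter> E)" if xA: "x \<in> A" for x
  proof -
    obtain p t where p: "p \<in> X" "t \<in> T" "x \<in> rectangle p t a b"
      using xA by (auto simp: A_def xF)
    \<comment> \<open>This end piece has area \<open>b * b\<close>, the fraction
      \<open>1 / \<sigma>\<close> of the whole rectangle, so the function equal to
      \<open>\<sigma>\<close> on \<open>E\<close> has average at least 1 there.\<close>
    have "rectangle p t b b \<subseteq> rectangle p t a b \<inter> E"
      using p ab rectangle_mono[of b a b b p t] rectangle_subset_cbox[of p t b b] by (auto simp: E_def C_def)
    moreover have "rectangle p t a b \<inter> E \<in> fmeasurable lborel"
      using E fmeasurable_rectangle by (intro fmeasurable_Int_fmeasurable) (auto simp: fmeasurable_def)
    ultimately have "measure lborel (rectangle p t b b) \<le> measure lborel (rectangle p t a b \<inter> E)"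
      by (intro measure_mono_fmeasurable) (auto simp: borel_open open_rectangle)
    then have "\<sigma> * (b * b) \<le> \<sigma> * measure lborel (rectangle p t a b \<inter> E)"
      using ab \<sigma> by (intro mult_left_mono) (auto simp: measure_rectangle)
    then have "measure lborel (rectangle p t a b) \<le> \<sigma> * measure lborel (rectangle p t a b \<inter> E)"
      using ab by (simp add: measure_rectangle)
    moreover have "diameter (rectangle p t a b) < e"
    proof -
      have "diameter (rectangle p t a b) \<le> 2 * (a + b)"
        using ab by (intro diameter_rectangle_le) auto
      also have "\<dots> \<le> 4 * a" using ab(3) by simp
      finally show ?thesis using ab(7) by simp
    qed
    ultimately show ?thesis
      using p ab by (intro exI[of _ "rectangle p t a b"] exI[of _ p] exI[of _ t] exI[of _ a] exI[of _ b])
        (simp add: measure_rectangle)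
  qed
  then show ?thesis
    using E E_le A A_ge by (intro exI[of _ E] exI[of _ A]) (auto simp: A_def Q_def)
qed

section \<open>Failure of differentiation\<close>

text \<open>Continuity from above along the decreasing tail unions, each of which contains some
  \<open>A n\<close> and lies in the set \<open>Q\<close> of finite measure.\<close>

lemma limsup_measure_ge:
  assumes A: "\<And>j. A j \<in> sets M" "\<And>j. A j \<subseteq> Q" and Q: "Q \<in> sets M" "emeasure M Q < \<infinity>"
    and c: "\<And>j. c \<le> emeasure M (A j)"
  shows "c \<le> emeasure M (\<Inter>n. \<Union>j\<in>{n..}. A (j::nat))"
proof -
  have fin: "emeasure M (\<Union>j\<in>{n..}. A j) \<noteq> \<infinity>" for n
  proof -
    have "emeasure M (\<Union>j\<in>{n..}. A j) \<le> emeasure M Q"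
      using A Q by (intro emeasure_mono) auto
    then show ?thesis using Q by (auto simp: top_unique)
  qed
  have "(INF n. emeasure M (\<Union>j\<in>{n..}. A j)) = emeasure M (\<Inter>n. \<Union>j\<in>{n..}. A j)"
  proof (rule INF_emeasure_decseq)
    show "decseq (\<lambda>n. \<Union>j\<in>{n..}. A j)"
      unfolding decseq_def by (intro allI impI UN_mono) auto
  qed (use A fin in auto)
  moreover have "c \<le> emeasure M (\<Union>j\<in>{n..}. A j)" for n
    using c[of n] A by (elim order_trans, intro emeasure_mono) auto
  ultimately show ?thesis by (metis INF_greatest)
qed

text \<open>The test function is the supremum of the functions equal to \<open>s j\<close> on
  \<open>E j\<close>. At a point in infinitely many \<open>A j\<close> but in no \<open>E j\<close>
  it vanishes, although its averages over arbitrarily small members of \<open>\<B>\<close> are at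
  least 1. Comparing measures with \<open>c\<close> shows that such points do not form a null
  set.\<close>

lemma spikes_not_differentiated:
  fixes s :: "nat \<Rightarrow> real" and E A :: "nat \<Rightarrow> (real^2) set"
  assumes young: "young_function \<Phi>"
    and s: "\<And>j. 0 \<le> s j"
    and E: "\<And>j. E j \<in> fmeasurable lborel"
    and E_sum: "summable (\<lambda>j. measure lborel (E j))" "(\<Sum>j. measure lborel (E j)) < c"
    and Phi_sum: "summable (\<lambda>j. \<Phi> (s j) * measure lborel (E j))"
    and A: "\<And>j. A j \<in> sets borel" "\<And>j. A j \<subseteq> Q" "Q \<in> fmeasurable lborel"
      "\<And>j. c \<le> measure lborel (A j)"
    and B: "\<And>j x. x \<in> A j \<Longrightarrow> \<exists>B\<in>\<B>. x \<in> B \<and> open B \<and> bounded B \<and> diameter B < 1 / real (Suc j)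
         \<and> 0 < measure lborel B \<and> measure lborel B \<le> s j * measure lborel (B \<inter> E j)"
  shows "\<not> differentiates \<B> (orlicz_space \<Phi>)"
proof
  assume diff: "differentiates \<B> (orlicz_space \<Phi>)"
  have Es: "E j \<in> sets borel" for j using E[of j] by (simp add: fmeasurable_def)
  note [measurable] = Es
  define g where "g j x = ennreal (s j) * indicator (E j) x" for j x
  \<comment> \<open>The supremum may be infinite on a null set, where \<open>enn2real\<close> returns 0.\<close>
  define f where "f x = enn2real (SUP j. g j x)" for x
  have [measurable]: "g j \<in> borel_measurable borel" for j unfolding g_def by measurable
  have f_borel: "f \<in> borel_measurable borel" unfolding f_def by measurable
  then have f_leb: "f \<in> borel_measurable lebesgue"
    by (intro measurable_completion) simp
  have f_nn: "0 \<le> f x" for x by (simp add: f_def)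
  have f_0: "f x = 0" if "x \<notin> (\<Union>j. E j)" for x
    using that by (simp add: f_def g_def)
  \<comment> \<open>By Borel-Cantelli almost every point lies in only finitely many
    \<open>E j\<close>, so there the supremum is an attained, finite maximum.\<close>
  have "AE x in lborel. eventually (\<lambda>j. x \<in> space lborel - E j) sequentially"
    using E E_sum by (intro borel_cantelli_AE1) (auto simp: fmeasurable_def)
  then have "AE x in lborel. (f x = 0 \<or> (\<exists>j. x \<in> E j \<and> f x = s j)) \<and> (\<forall>j. x \<in> E j \<longrightarrow> s j \<le> f x)"
  proof (rule AE_mp, intro AE_I2 impI)
    fix x :: "real^2"
    assume "eventually (\<lambda>j. x \<in> space lborel - E j) sequentially"
    then have "finite {j. x \<in> E j}"
      by (auto simp: eventually_sequentially finite_nat_set_iff_bounded not_le[symmetric])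
    \<comment> \<open>The inserted 0 is the value of \<open>g j x\<close> for all \<open>j\<close>
      with \<open>x\<close> outside \<open>E j\<close>.\<close>
    then have "finite (insert 0 ((\<lambda>j. g j x) ` {j. x \<in> E j}))" by simp
    moreover have "range (\<lambda>j. g j x) \<subseteq> insert 0 ((\<lambda>j. g j x) ` {j. x \<in> E j})"
      by (auto simp: g_def indicator_def)
    ultimately have fin: "finite (range (\<lambda>j. g j x))" by (rule finite_subset[rotated])
    then have "(SUP j. g j x) \<in> range (\<lambda>j. g j x)"
      using Max_in[OF fin] Max_Sup[OF fin] by auto
    then obtain i where i: "(SUP j. g j x) = g i x" by auto
    then have fi: "f x = s i * indicator (E i) x"
      using s[of i] unfolding f_def i by (simp add: g_def enn2real_mult indicator_def)
    have "s j \<le> f x" if "x \<in> E j" for j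
    proof -
      have "ennreal (s j) \<le> (SUP j. g j x)"
        using that by (intro SUP_upper2[of j]) (auto simp: g_def)
      also have "\<dots> = ennreal (f x)"
        using s[of i] unfolding i fi by (simp add: g_def indicator_def)
      finally show ?thesis using f_nn[of x] by (simp add: ennreal_le_iff)
    qed
    moreover have "f x = 0 \<or> (\<exists>j. x \<in> E j \<and> f x = s j)"
      using fi by (cases "x \<in> E i") auto
    ultimately show "(f x = 0 \<or> (\<exists>j. x \<in> E j \<and> f x = s j)) \<and> (\<forall>j. x \<in> E j \<longrightarrow> s j \<le> f x)"
      by blast
  qed
  then have good: "AE x in lebesgue. (f x = 0 \<or> (\<exists>j. x \<in> E j \<and> f x = s j))
      \<and> (\<forall>j. x \<in> E j \<longrightarrow> s j \<le> f x)"
    by (rule AE_completion)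
  have Phi: "\<And>t. 0 \<le> t \<Longrightarrow> 0 \<le> \<Phi> t" "\<Phi> 0 = 0" using young by (auto simp: young_function_def)
  \<comment> \<open>The scale \<open>\<mu> = 1\<close> suffices: almost everywhere
    \<open>\<Phi> (f x)\<close> is 0 or is dominated by the series through a single one of its
    terms.\<close>
  have "(\<integral>\<^sup>+x. ennreal (\<Phi> (\<bar>f x\<bar> / 1)) \<partial>lebesgue)
      \<le> (\<integral>\<^sup>+x. (\<Sum>j. ennreal (\<Phi> (s j)) * indicator (E j) x) \<partial>lebesgue)"
  proof (rule nn_integral_mono_AE, rule AE_mp[OF good], intro AE_I2 impI)
    fix x :: "real^2"
    assume x: "(f x = 0 \<or> (\<exists>j. x \<in> E j \<and> f x = s j)) \<and> (\<forall>j. x \<in> E j \<longrightarrow> s j \<le> f x)"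
    show "ennreal (\<Phi> (\<bar>f x\<bar> / 1)) \<le> (\<Sum>j. ennreal (\<Phi> (s j)) * indicator (E j) x)"
    proof (cases "f x = 0")
      case False
      then obtain j where j: "x \<in> E j" "f x = s j" using x by blast
      have "(\<Sum>i\<in>{j}. ennreal (\<Phi> (s i)) * indicator (E i) x)
          \<le> (\<Sum>j. ennreal (\<Phi> (s j)) * indicator (E j) x)"
        by (intro sum_le_suminf) auto
      then show ?thesis using j f_nn[of x] by simp
    qed (simp add: Phi)
  qed
  also have "\<dots> = (\<Sum>j. \<integral>\<^sup>+x. ennreal (\<Phi> (s j)) * indicator (E j) x \<partial>lebesgue)"
    by (intro nn_integral_suminf measurable_completion) measurable
  also have "\<dots> = (\<Sum>j. ennreal (\<Phi> (s j) * measure lborel (E j)))"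
  proof (rule suminf_cong)
    fix j
    have "(\<integral>\<^sup>+x. ennreal (\<Phi> (s j)) * indicator (E j) x \<partial>lebesgue) = ennreal (\<Phi> (s j)) * emeasure lebesgue (E j)"
      using Es by (intro nn_integral_cmult_indicator) simp
    then show "(\<integral>\<^sup>+x. ennreal (\<Phi> (s j)) * indicator (E j) x \<partial>lebesgue)
        = ennreal (\<Phi> (s j) * measure lborel (E j))"
      using E[of j] Es[of j] Phi s[of j] by (simp add: emeasure_eq_measure2 ennreal_mult)
  qed
  also have "\<dots> < \<infinity>"
    using Phi_sum Phi s by (simp add: suminf_ennreal_eq[OF _ summable_sums] less_top)
  finally have f_orlicz: "f \<in> orlicz_space \<Phi>"
    unfolding orlicz_space_def using f_leb by (intro CollectI conjI exI[of _ 1]) simp_all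
  have int_ge: "s j * measure lborel (B \<inter> E j) \<le> (LINT y:B|lebesgue. f y)"
    if B: "open B" "bounded B" for B j
  proof -
    \<comment> \<open>The closure of \<open>B\<close> is compact, so local integrability applies to
      it and then passes to \<open>B\<close>.\<close>
    have "set_integrable lebesgue (closure B) f"
      using f_orlicz orlicz_space_subset_L1_loc[OF young] B by (auto simp: L1_loc_def)
    then have "set_integrable lebesgue B f"
      by (rule set_integrable_subset) (use B closure_subset[of B] in \<open>auto simp: borel_open\<close>)
    then have int: "integrable lebesgue (\<lambda>y. indicator B y *\<^sub>R f y)"
      by (simp add: set_integrable_def)
    have BE: "B \<inter> E j \<in> sets borel" using B Es by (auto simp: borel_open)
    have "emeasure lborel (B \<inter> E j) \<le> emeasure lborel (E j)"
      using Es by (intro emeasure_mono) auto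
    then have BE_fin: "emeasure lborel (B \<inter> E j) < \<infinity>"
      using E[of j] by (auto simp: fmeasurable_def intro: le_less_trans)
    have "s j * measure lborel (B \<inter> E j) = (LINT y|lebesgue. s j * indicator (B \<inter> E j) y)"
      using BE by simp
    also have "\<dots> \<le> (LINT y|lebesgue. indicator B y *\<^sub>R f y)"
    proof (rule integral_mono_AE[OF _ int])
      show "integrable lebesgue (\<lambda>y. s j * indicator (B \<inter> E j) y)"
        using BE BE_fin by (intro integrable_mult_right integrable_real_indicator) auto
      show "AE y in lebesgue. s j * indicator (B \<inter> E j) y \<le> indicator B y *\<^sub>R f y"
        using good by (rule AE_mp) (auto simp: indicator_def f_nn intro!: AE_I2)
    qed
    finally show ?thesis by (simp add: set_lebesgue_integral_def)
  qed
  define D where "D = (\<Inter>n. \<Union>j\<in>{n..}. A j)"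
  define U where "U = (\<Union>j. E j)"
  have DU: "D \<in> sets borel" "U \<in> sets borel" unfolding D_def U_def using A Es by auto
  have "AE x in lebesgue. (average f \<longlongrightarrow> f x) (contracting_to \<B> x)"
    using diff f_orlicz by (simp add: differentiates_def differentiates_integral_def)
  then have "AE x in lebesgue. x \<notin> D - U"
  proof (rule AE_mp, intro AE_I2 impI notI)
    fix x assume lim: "(average f \<longlongrightarrow> f x) (contracting_to \<B> x)" and x: "x \<in> D - U"
    have "f x = 0" using x by (intro f_0) (auto simp: U_def)
    \<comment> \<open>Convergence to 0 with tolerance 1 would keep all averages over small sets
      below 1; an index \<open>j \<ge> n\<close> with \<open>x\<close> in \<open>A j\<close>
      supplies a set violating this.\<close>
    then obtain d where d: "d > 0"
      "\<And>B. B \<in> \<B> \<Longrightarrow> x \<in> B \<Longrightarrow> bounded B \<Longrightarrow> diameter B < d \<Longrightarrow> \<bar>average f B\<bar> < 1"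
      using lim[unfolded contracting_tendsto_iff, rule_format, of 1] by auto
    obtain n where n: "1 / real (Suc n) < d" using d nat_approx_posE by (metis)
    obtain j where j: "n \<le> j" "x \<in> A j" using x by (auto simp: D_def)
    obtain B where B': "B \<in> \<B>" "x \<in> B" "open B" "bounded B" "diameter B < 1 / real (Suc j)"
      "0 < measure lborel B" "measure lborel B \<le> s j * measure lborel (B \<inter> E j)"
      using B[OF j(2)] by blast
    have "1 / real (Suc j) \<le> 1 / real (Suc n)" using j by (simp add: field_simps)
    then have "\<bar>average f B\<bar> < 1" using B' n by (intro d) auto
    moreover have "measure lborel B \<le> (LINT y:B|lebesgue. f y)"
      using int_ge[of B j] B' by linarith
    then have "1 \<le> average f B" using B' by (simp add: average_def borel_open)
    ultimately show False by simp
  qed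
  then have "D - U \<in> null_sets lebesgue"
    using DU by (subst AE_iff_null_sets) auto
  then have null: "emeasure lborel (D - U) = 0"
    using DU by (auto simp: null_sets_def)
  \<comment> \<open>\<open>D\<close> has measure at least \<open>c\<close>, yet it is covered by the
    null set \<open>D - U\<close> and by \<open>U\<close>, whose measure is below
    \<open>c\<close>.\<close>
  have "ennreal c \<le> emeasure lborel D" unfolding D_def
  proof (rule limsup_measure_ge[of A lborel Q])
    fix j
    have "emeasure lborel (A j) \<le> emeasure lborel Q"
      using A by (intro emeasure_mono) (auto simp: fmeasurable_def)
    then have "emeasure lborel (A j) \<noteq> top"
      using A(3) by (auto simp: fmeasurable_def top_unique)
    then show "ennreal c \<le> emeasure lborel (A j)"
      using A(4)[of j] by (simp add: emeasure_eq_ennreal_measure ennreal_leI)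
  qed (use A in \<open>auto simp: fmeasurable_def\<close>)
  also have "\<dots> \<le> emeasure lborel ((D - U) \<union> U)" using DU by (intro emeasure_mono) auto
  also have "\<dots> \<le> emeasure lborel (D - U) + emeasure lborel U"
    using DU by (intro emeasure_subadditive) auto
  also have "\<dots> = emeasure lborel U" by (simp add: null)
  also have "\<dots> \<le> (\<Sum>j. emeasure lborel (E j))"
    unfolding U_def using Es by (intro emeasure_subadditive_countably) auto
  also have "\<dots> = (\<Sum>j. ennreal (measure lborel (E j)))"
    using E by (simp add: emeasure_eq_measure2)
  also have "\<dots> = ennreal (\<Sum>j. measure lborel (E j))"
    using E_sum by (intro suminf_ennreal_eq summable_sums) auto
  finally have "c \<le> (\<Sum>j. measure lborel (E j))"
    using E_sum by (simp add: ennreal_le_iff suminf_nonneg)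
  then show False using E_sum by simp
qed

section \<open>Angular separation, choice of indices and summation\<close>

theorem proposition6:
  fixes \<theta> \<sigma> :: "nat \<Rightarrow> real" and N :: "nat \<Rightarrow> nat"
    and \<Theta> :: "real set" and shape :: "real \<Rightarrow> real" and \<Phi> :: "real \<Rightarrow> real"
  assumes "\<And>k. \<theta> k \<in> {0<..<pi/4}"
    and "decseq \<theta>" and "\<theta> \<longlonglongrightarrow> 0"
    and "\<And>k. 0 < N k"
    and "\<And>k. 1 \<le> \<sigma> k"
    and "\<Theta> = {\<theta> (Suc k) + real (i - 1) / real (N k) * (\<theta> k - \<theta> (Suc k)) | k i. 1 \<le> i \<and> i \<le> N k}"
    and "\<And>k i. 1 \<le> i \<Longrightarrow> i \<le> N k \<Longrightarrow>
           shape (\<theta> (Suc k) + real (i - 1) / real (N k) * (\<theta> k - \<theta> (Suc k))) = \<sigma> k"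
    and "\<And>k. sin ((\<theta> k - \<theta> (Suc k)) / real (N k)) \<ge> 4 / \<sigma> k"
    and "young_function \<Phi>"
    and "differentiates (rectangle_basis \<Theta> shape) (orlicz_space \<Phi>)"
  shows "(\<lambda>k. real (N k) * \<sigma> k) \<in> O(\<lambda>k. \<Phi> (\<sigma> k))"
proof (rule ccontr)
  assume not_O: "(\<lambda>k. real (N k) * \<sigma> k) \<notin> O(\<lambda>k. \<Phi> (\<sigma> k))"
  have Phi: "\<And>t. 0 \<le> t \<Longrightarrow> 0 \<le> \<Phi> t" using assms(9) by (auto simp: young_function_def)
  have \<sigma>_pos: "0 < \<sigma> k" for k using assms(5)[of k] by simp
  have \<sigma>4: "4 \<le> \<sigma> k" for k
    using order_trans[OF assms(8)[of k] sin_le_one] \<sigma>_pos[of k] by (simp add: field_simps)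
  define \<delta> where "\<delta> k = (\<theta> k - \<theta> (Suc k)) / real (N k)" for k
  have \<delta>: "0 < \<delta> k" "real (N k) * \<delta> k < pi / 4" "4 / \<sigma> k \<le> sin (\<delta> k)"
     "\<delta> k \<le> \<theta> k" for k
  proof -
    have "0 \<le> \<delta> k" using assms(2) by (simp add: \<delta>_def decseq_SucD)
    moreover show s: "4 / \<sigma> k \<le> sin (\<delta> k)" using assms(8) by (simp add: \<delta>_def)
    moreover have "0 < 4 / \<sigma> k" using \<sigma>_pos by simp
    \<comment> \<open>The case \<open>\<delta> k = 0\<close> would give
      \<open>sin (\<delta> k) = 0\<close>, below \<open>4 / \<sigma> k\<close>; in particular
      \<open>\<theta>\<close> decreases strictly.\<close>
    ultimately show pos: "0 < \<delta> k" by (cases "\<delta> k = 0") auto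
    have eq: "real (N k) * \<delta> k = \<theta> k - \<theta> (Suc k)" using assms(4)[of k] by (simp add: \<delta>_def)
    then show "real (N k) * \<delta> k < pi / 4" using assms(1)[of k] assms(1)[of "Suc k"] by auto
    have "1 * \<delta> k \<le> real (N k) * \<delta> k"
      using assms(4)[of k] pos by (intro mult_right_mono) auto
    then show "\<delta> k \<le> \<theta> k" using eq assms(1)[of "Suc k"] by simp
  qed
  define T where "T k = (\<lambda>i. \<theta> (Suc k) + real (i - 1) / real (N k) * (\<theta> k - \<theta> (Suc k))) ` {1..N k}" for k
  have \<tau>: "\<theta> (Suc k) + real (i - 1) / real (N k) * (\<theta> k - \<theta> (Suc k)) = \<theta> (Suc k) + real (i - 1) * \<delta> k" for k i
    by (simp add: \<delta>_def)
  have T: "finite (T k)" "T k \<noteq> {}" for k using assms(4)[of k] by (auto simp: T_def)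
  have card_T: "card (T k) = N k" for k
  proof -
    have "inj_on (\<lambda>i. \<theta> (Suc k) + real (i - 1) * \<delta> k) {1..N k}"
      using \<delta>(1)[of k] by (auto simp: inj_on_def)
    from card_image[OF this] show ?thesis unfolding T_def \<tau> by simp
  qed
  have T_shape: "t \<in> \<Theta>" "shape t = \<sigma> k" if tT: "t \<in> T k" for t k
  proof -
    obtain i where "1 \<le> i" "i \<le> N k" "t = \<theta> (Suc k) + real (i - 1) / real (N k) * (\<theta> k - \<theta> (Suc k))"
      using tT unfolding T_def by auto
    then show "t \<in> \<Theta>" "shape t = \<sigma> k" using assms(7) unfolding assms(6) by blast+
  qed
  have sep: "t - s < pi \<and> 4 / \<sigma> k \<le> sin (t - s)" if st: "s \<in> T k" "t \<in> T k" "s < t" for s t k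
  proof -
    obtain i j where ij: "i \<in> {1..N k}" "j \<in> {1..N k}"
      "s = \<theta> (Suc k) + real (i - 1) * \<delta> k" "t = \<theta> (Suc k) + real (j - 1) * \<delta> k"
      using st(1,2) unfolding T_def \<tau> by blast
    then have "i < j" using st(3) \<delta>(1)[of k] by auto
    have ts: "t - s = real (j - i) * \<delta> k"
      using ij \<open>i < j\<close> by (simp add: of_nat_diff algebra_simps)
    have "1 * \<delta> k \<le> real (j - i) * \<delta> k"
      using \<open>i < j\<close> \<delta>(1)[of k] by (intro mult_right_mono) auto
    moreover have "real (j - i) * \<delta> k \<le> real (N k) * \<delta> k"
      using ij \<delta>(1)[of k] by (intro mult_right_mono) auto
    ultimately have ts': "\<delta> k \<le> t - s" "t - s < pi / 4" using ts \<delta>(2)[of k] by auto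
    \<comment> \<open>Two directions in \<open>T k\<close> differ by a multiple of
      \<open>\<delta> k\<close> that stays below \<open>pi / 4\<close>, in the range where the sine
      increases.\<close>
    then have "sin (\<delta> k) \<le> sin (t - s)"
      using \<delta>(1)[of k] pi_gt_zero by (intro sin_monotone_2pi_le) linarith+
    then show ?thesis using ts' \<delta>(3)[of k] pi_gt_zero by linarith
  qed
  \<comment> \<open>Both bounds must hold at the same \<open>k\<close>. The first holds for all
    large \<open>k\<close>, since \<open>4 / \<sigma> k \<le> \<delta> k \<le> \<theta> k\<close>
    and \<open>\<theta>\<close> tends to 0; the second holds for arbitrarily large \<open>k\<close>
    by \<open>not_O\<close>.\<close>
  have "\<exists>k. 4000 * 2 ^ j \<le> real (N k) * \<sigma> k \<and> 2 ^ j * \<Phi> (\<sigma> k) \<le> real (N k) * \<sigma> k" for j :: nat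
  proof -
    define c where "c = (4000 * 2 ^ j :: real)"
    have c: "0 < c" by (simp add: c_def)
    have "eventually (\<lambda>k. \<theta> k < 4 / c) sequentially"
      using assms(3) c by (intro order_tendstoD) auto
    \<comment> \<open>If the bound with constant \<open>2 ^ j\<close> held whenever
      \<open>\<theta> k < 4 / c\<close>, it would hold eventually, contrary to
      \<open>not_O\<close>.\<close>
    then have "\<not> (\<forall>k. \<theta> k < 4 / c \<longrightarrow> norm (real (N k) * \<sigma> k) \<le> 2 ^ j * norm (\<Phi> (\<sigma> k)))"
      using not_O by (metis (mono_tags, lifting) bigoI eventually_mono)
    then obtain k where k: "\<theta> k < 4 / c" "\<not> (norm (real (N k) * \<sigma> k) \<le> 2 ^ j * norm (\<Phi> (\<sigma> k)))"
      by auto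
    have "4 / \<sigma> k \<le> \<delta> k" using \<delta>(1,3)[of k] sin_x_le_x[of "\<delta> k"] by linarith
    then have "4 / \<sigma> k < 4 / c" using \<delta>(4)[of k] k(1) by linarith
    then have "c \<le> 1 * \<sigma> k" using c \<sigma>_pos[of k] by (simp add: field_simps)
    also have "\<dots> \<le> real (N k) * \<sigma> k"
      using assms(4)[of k] \<sigma>_pos[of k] by (intro mult_right_mono) auto
    finally have "c \<le> real (N k) * \<sigma> k" .
    then show ?thesis using k(2) Phi[of "\<sigma> k"] \<sigma>_pos[of k] by (intro exI[of _ k]) (auto simp: c_def)
  qed
  then obtain K where K: "\<And>j. 4000 * 2 ^ j \<le> real (N (K j)) * \<sigma> (K j)"
    "\<And>j. 2 ^ j * \<Phi> (\<sigma> (K j)) \<le> real (N (K j)) * \<sigma> (K j)" by metis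
  \<comment> \<open>A name for the conclusion of \<open>fan_translates\<close> with
    \<open>e = 1 / real (Suc j)\<close>, so that \<open>E j\<close> and \<open>A j\<close> can be
    chosen for all \<open>j\<close> at once. The diameters shrink through \<open>e\<close>, whatever
    the order of the values of \<open>K\<close>.\<close>
  define fan where "fan j E A \<longleftrightarrow> E \<in> fmeasurable lborel \<and>
     measure lborel E * (real (card (T (K j))) * \<sigma> (K j)) \<le> 864 \<and>
     A \<in> sets borel \<and> A \<subseteq> cbox 0 (\<chi> i. 1) \<and> 1 / 2 \<le> measure lborel A \<and>
     (\<forall>x\<in>A. \<exists>B p t a b. B = rectangle p t a b \<and> t \<in> T (K j) \<and> 0 < b \<and> b \<le> a \<and> a / b = \<sigma> (K j) \<and>
        x \<in> B \<and> diameter B < 1 / real (Suc j) \<and> 0 < measure lborel B \<and>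
        measure lborel B \<le> \<sigma> (K j) * measure lborel (B \<inter> E))" for j E A
  have "\<exists>E A. fan j E A" for j
    unfolding fan_def by (rule fan_translates[OF T \<sigma>4 _ _ sep]) (auto simp: field_simps)
  then obtain E A where EA: "\<And>j. fan j (E j) (A j)" by metis
  have E_le: "measure lborel (E j) * (real (N (K j)) * \<sigma> (K j)) \<le> 864" for j
    using EA[of j] by (simp add: fan_def card_T)
  \<comment> \<open>Here \<open>27/125\<close> is \<open>864 / 4000\<close>; the factor 4000 is
    large enough for the sum over \<open>j\<close>, which is at most \<open>54/125\<close>, to stay
    below \<open>1/2\<close>.\<close>
  have E1: "measure lborel (E j) \<le> 27/125 * (1/2) ^ j" for j
  proof -
    have "measure lborel (E j) * (4000 * 2 ^ j) \<le> 864"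
      by (rule order_trans[OF mult_left_mono[OF K(1)] E_le]) auto
    then show ?thesis by (simp add: field_simps power_one_over)
  qed
  \<comment> \<open>The weight \<open>2 ^ j\<close> in the second property of \<open>K\<close> turns
    the uniform bound 864 into a summable one.\<close>
  have E2: "\<Phi> (\<sigma> (K j)) * measure lborel (E j) \<le> 864 * (1/2) ^ j" for j
  proof -
    have "measure lborel (E j) * (2 ^ j * \<Phi> (\<sigma> (K j))) \<le> 864"
      by (rule order_trans[OF mult_left_mono[OF K(2)] E_le]) auto
    then show ?thesis by (simp add: field_simps power_one_over)
  qed
  have geom: "summable (\<lambda>j. c * (1/2) ^ j)" for c :: real
    by (intro summable_mult summable_geometric) simp
  have sumE: "summable (\<lambda>j. measure lborel (E j))"
    by (rule summable_comparison_test'[OF geom[of "27/125"], of 0]) (use E1 in simp)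
  have "(\<Sum>j. measure lborel (E j)) \<le> (\<Sum>j. 27/125 * (1/2) ^ j)"
    using E1 by (intro suminf_le sumE geom) auto
  also have "\<dots> = 27/125 * (1 / (1 - 1/2))"
    by (intro sums_unique[symmetric] sums_mult geometric_sums) simp
  also have "\<dots> < 1 / 2" by simp
  finally have small: "(\<Sum>j. measure lborel (E j)) < 1 / 2" .
  have "\<not> differentiates (rectangle_basis \<Theta> shape) (orlicz_space \<Phi>)"
  proof (rule spikes_not_differentiated[OF assms(9), of "\<lambda>j. \<sigma> (K j)" E "1/2" A "cbox 0 (\<chi> i. 1)"])
    show "summable (\<lambda>j. \<Phi> (\<sigma> (K j)) * measure lborel (E j))"
      by (rule summable_comparison_test'[OF geom[of 864], of 0])
        (use E2 Phi \<sigma>_pos in \<open>simp add: less_imp_le\<close>)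
    fix j x assume "x \<in> A j"
    then obtain B p t a b where B: "B = rectangle p t a b" "t \<in> T (K j)" "0 < b" "b \<le> a" "a / b = \<sigma> (K j)"
        "x \<in> B" "diameter B < 1 / real (Suc j)" "0 < measure lborel B"
        "measure lborel B \<le> \<sigma> (K j) * measure lborel (B \<inter> E j)"
      using EA[of j] unfolding fan_def by blast
    have "a / b = shape t" using B(5) T_shape[OF B(2)] by simp
    then have "B \<in> rectangle_basis \<Theta> shape"
      using B(1,3,4) T_shape[OF B(2)] unfolding rectangle_basis_def by blast
    then show "\<exists>B\<in>rectangle_basis \<Theta> shape. x \<in> B \<and> open B \<and> bounded B \<and> diameter B < 1 / real (Suc j)
        \<and> 0 < measure lborel B \<and> measure lborel B \<le> \<sigma> (K j) * measure lborel (B \<inter> E j)"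
      using B(6-9) by (intro bexI[of _ B]) (auto simp: B(1) open_rectangle bounded_rectangle)
  qed (use EA sumE small \<sigma>_pos in \<open>auto simp: fan_def less_imp_le fmeasurable_cbox_lborel\<close>)
  then show False using assms(10) by simp
qed

end
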